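(* Let $\theta,\kappa\in\mathbb R$ and $a,b\in\mathbb C$ with $|a|<1$, $|b|<1$, and let $$e_{+}=\frac{1}{\sqrt{1+|a|^2\lambda^{2}}}\begin{pmatrix} e^{i\theta} & a\lambda\\ -\bar a\lambda & e^{-i\theta}\end{pmatrix},\qquad e_{-}=\frac{1}{\sqrt{1+|b|^2\lambda^{-2}}}\begin{pmatrix} e^{i\kappa} & b\lambda^{-1}\\ -\bar b\lambda^{-1} & e^{-i\kappa}\end{pmatrix}.$$ Then there exist $\tilde e_{+}\in\Lambda^{+}\mathrm{SU}_2$ and $\tilde e_{-}\in\Lambda^{-}\mathrm{SU}_2$ such that $$e_+e_-=\tilde e_-\tilde e_+ .$$ In particular, $\tilde e_\pm$ can be taken explicitly as $$\tilde e_{+}=\frac{1}{\sqrt{1+|\tilde a|^2\lambda^{2}}}\begin{pmatrix} e^{i\tilde\theta} & \tilde a\lambda\\ -\overline{\tilde a}\lambda & e^{-i\tilde\theta}\end{pmatrix},\qquad \tilde e_{-}=\frac{1}{\sqrt{1+|\tilde b|^2\lambda^{-2}}}\begin{pmatrix} e^{i\tilde\kappa} & \tilde b\lambda^{-1}\\ -\overline{\tilde b}\lambda^{-1} & e^{-i\tilde\kappa}\end{pmatrix},$$ where $\tilde\theta,\tilde\kappa\in\mathbb R$ and $\tilde a,\tilde b\in\mathbb C$ are chosen to satisfy $$\tilde a=a e^{-i(\kappa+\tilde\kappa)},\qquad \tilde b=b e^{i(\theta+\tilde\theta)},\qquad \tilde\theta+\tilde\kappa=\theta+\kappa+2\arg\bigl(1-a\bar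 b e^{-i(\theta+\kappa)}\bigr).$$ The matrices $\tilde e_\pm$ are not unique, and one can always choose $\tilde\theta=0$, or alternatively always choose $\tilde\kappa=0$.
   Context: The twisted $\mathrm{SU}_2$-loop group $\Lambda\mathrm{SU}_2$ is the group (under pointwise multiplication in $\lambda$) of smooth maps $g:\mathbb R^{\times}\cup S^1\to \mathrm{SL}_2\mathbb C$, where $\mathbb R^\times=\mathbb R\setminus\{0\}$ and $S^1$ is the unit circle in $\mathbb C$, such that $g(\lambda)=\bigl(\overline{g(\bar\lambda)}^{\,-1}\bigr)^{T}$ and $\sigma_3\, g(\lambda)\,\sigma_3^{-1}=g(-\lambda)$ with $\sigma_3=\mathrm{diag}(1,-1)$; the matrix entries restricted to $S^1$ are required to lie in the Wiener algebra (absolutely summable Fourier series). Let $\mathbb D^+$ be the open unit disk in $\mathbb C$ and $\mathbb D^-$ the exterior of the unit disk together with $\infty$. Then $\Lambda^{\pm}\mathrm{SU}_2$ is the subgroup of those $g\in\Lambda\mathrm{SU}_2$ that extend analytically to $\mathbb D^{\pm}$. The variable $\lambda$ is the loop parameter. Square roots are principal branches (on $S^1$, and on $\mathbb D^+$ for $e_+$, $\mathbb D^-$ for $e_-$, the radicand has positive real part because $|a|,|b|<1$; for real $\lambda$ the radicand is positive). *)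

theory Defs
  imports "HOL-Analysis.Analysis"
begin

definition mat2 :: "complex \<Rightarrow> complex \<Rightarrow> complex \<Rightarrow> complex \<Rightarrow> complex^2^2" where
  "mat2 p q r s = vector [vector [p, q], vector [r, s]]"

definition sigma3 :: "complex^2^2" where
  "sigma3 = mat2 1 0 0 (-1)"

text \<open>A loop is represented by a total function on the complex numbers; only its values on
  the following set are meaningful, so loops are always compared there only.\<close>

definition loop_domain :: "complex set" where
  "loop_domain = {of_real t |t. t \<noteq> (0::real)} \<union> sphere 0 1"

text \<open>Differentiability is real (Frechet) differentiability, all directional derivatives
  being required to be differentiable one time less.\<close>

primrec Ck_on :: "nat \<Rightarrow> 'a::real_normed_vector set \<Rightarrow> ('a \<Rightarrow> 'b::real_normed_vector) \<Rightarrow> bool" where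
  "Ck_on 0 U f \<longleftrightarrow> continuous_on U f"
| "Ck_on (Suc k) U f \<longleftrightarrow> (\<forall>x\<in>U. f differentiable (at x)) \<and>
     (\<forall>v. Ck_on k U (\<lambda>x. frechet_derivative f (at x) v))"

text \<open>Smoothness on an arbitrary subset of a normed space: existence of a smooth extension
  to an open neighbourhood. The real line and the unit circle cross transversally at
  \<open>1\<close> and \<open>-1\<close>, so on \<^const>\<open>loop_domain\<close> this agrees with smoothness along each of the two curves.\<close>

definition smooth_on :: "'a::real_normed_vector set \<Rightarrow> ('a \<Rightarrow> 'b::real_normed_vector) \<Rightarrow> bool" where
  "smooth_on S f \<longleftrightarrow>
     (\<exists>U F. open U \<and> S \<subseteq> U \<and> (\<forall>k. Ck_on k U F) \<and> (\<forall>x\<in>S. F x = f x))"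

text \<open>The coefficients \<open>c\<close> are necessarily the Fourier coefficients of \<open>f\<close>, because an absolutely
  summable Fourier series converges uniformly.\<close>

definition wiener :: "(complex \<Rightarrow> complex) \<Rightarrow> bool" where
  "wiener f \<longleftrightarrow> (\<exists>c::int \<Rightarrow> complex. (\<lambda>n. norm (c n)) summable_on UNIV \<and>
     (\<forall>z\<in>sphere 0 1. ((\<lambda>n. c n * z powi n) has_sum f z) UNIV))"

definition LambdaSU2 :: "(complex \<Rightarrow> complex^2^2) set" where
  "LambdaSU2 = {g.
     smooth_on loop_domain g \<and>
     (\<forall>z\<in>loop_domain. det (g z) = 1) \<and>
     (\<forall>z\<in>loop_domain. g z = transpose (matrix_inv (map_matrix cnj (g (cnj z))))) \<and>
     (\<forall>z\<in>loop_domain. sigma3 ** g z ** matrix_inv sigma3 = g (- z)) \<and>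
     (\<forall>i j. wiener (\<lambda>z. g z $ i $ j))}"

text \<open>Analytic extension into the unit disk: the extension is continuous up to the boundary circle
  and agrees with \<open>g\<close> wherever \<open>g\<close> is already defined on the closed disk.\<close>

definition extends_to_disk :: "(complex \<Rightarrow> complex^2^2) \<Rightarrow> bool" where
  "extends_to_disk g \<longleftrightarrow> (\<exists>G.
     continuous_on (cball 0 1) G \<and>
     (\<forall>i j. (\<lambda>z. G z $ i $ j) holomorphic_on ball 0 1) \<and>
     (\<forall>z\<in>cball 0 1. det (G z) = 1) \<and>
     (\<forall>z\<in>loop_domain \<inter> cball 0 1. G z = g z))"

definition LambdaSU2_plus :: "(complex \<Rightarrow> complex^2^2) set" where
  "LambdaSU2_plus = {g \<in> LambdaSU2. extends_to_disk g}"

text \<open>The exterior of the unit disk together with infinity is described in the chart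
  \<open>w = 1 / z\<close>, in which it is the unit disk, infinity being \<open>w = 0\<close>.\<close>

definition LambdaSU2_minus :: "(complex \<Rightarrow> complex^2^2) set" where
  "LambdaSU2_minus = {g \<in> LambdaSU2. extends_to_disk (\<lambda>w. g (inverse w))}"

definition e_plus :: "real \<Rightarrow> complex \<Rightarrow> complex \<Rightarrow> complex^2^2" where
  "e_plus \<theta> a z = map_matrix ((*) (1 / csqrt (1 + of_real ((cmod a)\<^sup>2) * z\<^sup>2)))
     (mat2 (cis \<theta>) (a * z) (- cnj a * z) (cis (- \<theta>)))"

definition e_minus :: "real \<Rightarrow> complex \<Rightarrow> complex \<Rightarrow> complex^2^2" where
  "e_minus \<kappa> b z = map_matrix ((*) (1 / csqrt (1 + of_real ((cmod b)\<^sup>2) * z powi (-2))))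
     (mat2 (cis \<kappa>) (b * inverse z) (- cnj b * inverse z) (cis (- \<kappa>)))"

text \<open>The relations imposed on the new parameters \<open>\<theta>', \<kappa>', a', b'\<close>. The principal argument is a
  harmless choice: another determination changes \<open>\<theta>' + \<kappa>'\<close> by a multiple of \<open>4\<pi>\<close>.\<close>

definition refactor_params ::
  "real \<Rightarrow> real \<Rightarrow> complex \<Rightarrow> complex \<Rightarrow> real \<Rightarrow> real \<Rightarrow> complex \<Rightarrow> complex \<Rightarrow> bool" where
  "refactor_params \<theta> \<kappa> a b \<theta>' \<kappa>' a' b' \<longleftrightarrow>
     a' = a * cis (- (\<kappa> + \<kappa>')) \<and>
     b' = b * cis (\<theta> + \<theta>') \<and>
     \<theta>' + \<kappa>' = \<theta> + \<kappa> + 2 * Arg (1 - a * cnj b * cis (- (\<theta> + \<kappa>)))"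

end

theory Submission
  imports Defs "HOL-Complex_Analysis.Cauchy_Integral_Formula"
begin

text \<open>Clearing the scalar factors, the identity \<open>e\<^sub>+ e\<^sub>- = e\<^sub>-' e\<^sub>+'\<close> splits into an off-diagonal part,
  which fixes \<open>a'\<close> and \<open>b'\<close>, and a diagonal part
  \<open>exp (i (\<theta>' + \<kappa>')) (cnj w) = exp (i (\<theta> + \<kappa>)) w\<close> with \<open>w = 1 - a (cnj b) exp (-i (\<theta> + \<kappa>)) \<noteq> 0\<close>,
  which fixes \<open>\<theta>' + \<kappa>'\<close>; the scalar factors agree because \<open>|a'| = |a|\<close> and \<open>|b'| = |b|\<close>.
  For membership in the loop groups, \<open>e\<^sub>+\<close> is holomorphic where its radicand avoids the
  negative real axis, an open set containing the loop domain and a disk of radius larger than 1;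
  this gives smoothness and, by absolute convergence of the Taylor series, the Wiener condition.
  The factor \<open>e\<^sub>-\<close> is \<open>e\<^sub>+\<close> composed with inversion.\<close>

section \<open>Two-by-two matrices\<close>

lemma mat2_nth [simp]:
  "mat2 p q r s $ 1 $ 1 = p" "mat2 p q r s $ 1 $ 2 = q"
  "mat2 p q r s $ 2 $ 1 = r" "mat2 p q r s $ 2 $ 2 = s"
  by (simp_all add: mat2_def)

lemma mat2_mult:
  "mat2 p q r s ** mat2 p' q' r' s' =
     mat2 (p * p' + q * r') (p * q' + q * s') (r * p' + s * r') (r * q' + s * s')"
  by (simp add: vec_eq_iff forall_2 matrix_matrix_mult_def sum_2)

lemma mat2_eq_iff:
  "mat2 p q r s = mat2 p' q' r' s' \<longleftrightarrow> p = p' \<and> q = q' \<and> r = r' \<and> s = s'"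
  by (simp add: vec_eq_iff forall_2)

lemma map_matrix_mat2: "map_matrix f (mat2 p q r s) = mat2 (f p) (f q) (f r) (f s)"
  by (simp add: vec_eq_iff forall_2 map_matrix_def)

lemma transpose_mat2: "transpose (mat2 p q r s) = mat2 p r q s"
  by (simp add: vec_eq_iff forall_2 transpose_def)

lemma det_mat2: "det (mat2 p q r s) = p * s - q * r"
  by (simp add: det_2)

lemma mat_1_eq_mat2: "mat 1 = mat2 1 0 0 1"
  by (simp add: vec_eq_iff forall_2 mat_def)

text \<open>\<open>matrix_inv\<close> is a Hilbert choice among two-sided inverses. \<open>B\<close>
  shows that one exists, and the usual argument \<open>B = B (A X) = (B A) X = X\<close> identifies
  the chosen one with \<open>B\<close>.\<close>

lemma matrix_inv_eqI:
  assumes "A ** B = mat 1" "B ** A = mat 1"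
  shows "matrix_inv A = B"
proof -
  have "A ** matrix_inv A = mat 1 \<and> matrix_inv A ** A = mat 1"
    unfolding matrix_inv_def by (rule someI) (use assms in blast)
  then have "matrix_inv A = B ** A ** matrix_inv A" "B ** (A ** matrix_inv A) = B"
    using assms by simp_all
  then show ?thesis
    by (simp add: matrix_mul_assoc)
qed

lemma matrix_inv_mat2:
  assumes "p * s - q * r = 1"
  shows "matrix_inv (mat2 p q r s) = mat2 s (- q) (- r) p"
  by (rule matrix_inv_eqI) (use assms in \<open>simp_all add: mat2_mult mat_1_eq_mat2 mat2_eq_iff algebra_simps\<close>)

lemma matrix_inv_sigma3: "matrix_inv sigma3 = sigma3"
  unfolding sigma3_def
  by (rule matrix_inv_eqI) (simp_all add: mat2_mult mat_1_eq_mat2)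

section \<open>Smoothness and the Wiener algebra from holomorphy\<close>

text \<open>Basis vectors of the product are \<open>axis i u\<close>, and the inner product with one
  of them sees only component \<open>i\<close>. Applied twice, this gives the derivative of a
  matrix-valued map.\<close>

lemma has_derivative_vec_lambda:
  fixes f :: "'n::finite \<Rightarrow> 'a::real_normed_vector \<Rightarrow> 'b::euclidean_space"
  assumes "\<And>i. (f i has_derivative f' i) (at x within S)"
  shows "((\<lambda>x. \<chi> i. f i x) has_derivative (\<lambda>h. \<chi> i. f' i h)) (at x within S)"
  unfolding has_derivative_componentwise_within [of "\<lambda>x. \<chi> i. f i x"]
proof
  fix k :: "'b ^ 'n" assume "k \<in> Basis"
  then obtain i u where k: "k = axis i u" "u \<in> Basis"
    by (auto simp: Basis_vec_def)
  then show "((\<lambda>x. (\<chi> i. f i x) \<bullet> k) has_derivative (\<lambda>h. (\<chi> i. f' i h) \<bullet> k)) (at x within S)"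
    using assms [of i] by (simp add: inner_axis has_derivative_inner_left)
qed

text \<open>In a fixed direction \<open>v\<close> the Frechet derivative has entries
  \<open>deriv f x * v\<close>, which are again holomorphic on \<open>U\<close>. Hence the induction
  runs with \<open>F\<close> arbitrary.\<close>

lemma Ck_on_holomorphic_entries:
  fixes F :: "complex \<Rightarrow> complex^'n::finite^'m::finite"
  assumes "open U" "\<And>i j. (\<lambda>z. F z $ i $ j) holomorphic_on U"
  shows "Ck_on k U F"
  using assms(2)
proof (induction k arbitrary: F)
  case 0
  have "continuous_on U (\<lambda>z. \<chi> i j. F z $ i $ j)"
    using 0 by (intro continuous_on_vec_lambda holomorphic_on_imp_continuous_on)
  then show ?case
    by simp
next
  case (Suc k)
  have D: "(F has_derivative (\<lambda>v. \<chi> i j. deriv (\<lambda>z. F z $ i $ j) x * v)) (at x)"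
    if "x \<in> U" for x
  proof -
    have "((\<lambda>z. F z $ i $ j) has_derivative (\<lambda>v. deriv (\<lambda>z. F z $ i $ j) x * v)) (at x)" for i j
      using holomorphic_derivI [OF Suc.prems \<open>open U\<close> that]
      by (simp add: has_field_derivative_def)
    then have "((\<lambda>z. \<chi> i j. F z $ i $ j) has_derivative
                (\<lambda>v. \<chi> i j. deriv (\<lambda>z. F z $ i $ j) x * v)) (at x)"
      by (intro has_derivative_vec_lambda)
    then show ?thesis
      by simp
  qed
  have "Ck_on k U (\<lambda>x. frechet_derivative F (at x) v)" for v
  proof (rule Suc.IH)
    fix i j
    have "(\<lambda>x. deriv (\<lambda>z. F z $ i $ j) x * v) holomorphic_on U"
      by (intro holomorphic_intros holomorphic_deriv Suc.prems \<open>open U\<close>)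
    then show "(\<lambda>x. frechet_derivative F (at x) v $ i $ j) holomorphic_on U"
      by (rule holomorphic_transform) (simp flip: frechet_derivative_at [OF D])
  qed
  then show ?case
    using D by (auto simp: differentiable_def)
qed

lemma smooth_on_holomorphic_entries:
  fixes F :: "complex \<Rightarrow> complex^'n::finite^'m::finite"
  assumes "open U" "S \<subseteq> U" "\<And>i j. (\<lambda>z. F z $ i $ j) holomorphic_on U"
  shows "smooth_on S F"
  unfolding smooth_on_def
  by (intro exI [of _ U] exI [of _ F]) (simp add: assms Ck_on_holomorphic_entries)

text \<open>The Taylor series at 0 has radius of convergence above 1, so it converges absolutely on
  the unit circle and serves as Fourier series, with zero coefficients at negative indices.\<close>

lemma wiener_holomorphic:
  assumes "f holomorphic_on ball 0 R" "1 < R"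
  shows "wiener f"
proof -
  define a where "a n = (deriv ^^ n) f 0 / fact n" for n
  define c where "c n = (if 0 \<le> n then a (nat n) else 0)" for n :: int
  \<comment> \<open>Convergence at the intermediate radius \<open>r\<close> forces absolute
    convergence strictly inside it, in particular on the unit circle.\<close>
  obtain r where r: "1 < r" "r < R"
    using assms(2) dense by blast
  have sums: "(\<lambda>n. a n * w ^ n) sums f w" if "norm w < R" for w
    using holomorphic_power_series [OF assms(1), of w] that by (simp add: a_def)
  have abs: "summable (\<lambda>n. norm (a n * z ^ n))" if "norm z = 1" for z
    using powser_insidea [OF sums_summable [OF sums [of "of_real r"]], of z] r that by simp
  \<comment> \<open>Passage from sums over naturals to sums over integers. The term \<open>h\<close>
    is generic so that one argument serves both the norms and the Fourier series;
    \<open>h 0 n = 0\<close> kills the negative indices.\<close>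
  have c: "((\<lambda>n. h (c n) n) has_sum s) UNIV"
    if "((\<lambda>n. h (a n) (int n)) has_sum s) UNIV" and "\<And>n. h 0 n = 0"
    for h :: "complex \<Rightarrow> int \<Rightarrow> 'b::topological_comm_monoid_add" and s
  proof -
    have "((\<lambda>n. h (c n) n) has_sum s) (range int)"
      using that(1) by (subst has_sum_reindex) (simp_all add: o_def c_def)
    moreover have "c n = 0" if "n \<notin> range int" for n
      using that zero_le_imp_eq_int [of n] by (auto simp: c_def)
    ultimately show ?thesis
      by (subst has_sum_cong_neutral [where T = "range int"]) (auto simp: that(2))
  qed
  show ?thesis
    unfolding wiener_def
  proof (intro exI conjI ballI)
    have "(\<lambda>n. norm (a n)) summable_on UNIV"
      using abs [of 1] by (intro norm_summable_imp_summable_on) simp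
    then show "(\<lambda>n. norm (c n)) summable_on UNIV"
      using c [of "\<lambda>x n. norm x"] by (auto simp: summable_on_def)
  next
    fix z :: complex assume "z \<in> sphere 0 1"
    then have "((\<lambda>n. a n * z ^ n) has_sum f z) UNIV"
      using assms(2) by (intro norm_summable_imp_has_sum abs sums) auto
    then show "((\<lambda>n. c n * z powi n) has_sum f z) UNIV"
      using c [of "\<lambda>x n. x * z powi n"] by simp
  qed
qed

text \<open>Inversion preserves the unit circle and exchanges the Fourier modes \<open>n\<close> and
  \<open>-n\<close>.\<close>

lemma wiener_inverse:
  assumes "wiener f"
  shows "wiener (\<lambda>z. f (inverse z))"
proof -
  obtain c where c: "(\<lambda>n. norm (c n)) summable_on UNIV"
    "\<And>z. z \<in> sphere 0 1 \<Longrightarrow> ((\<lambda>n. c n * z powi n) has_sum f z) UNIV"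
    using assms by (auto simp: wiener_def)
  have bij: "bij_betw uminus (UNIV :: int set) UNIV"
    by (rule bij_betwI [of _ _ _ uminus]) auto
  show ?thesis
    unfolding wiener_def
  proof (intro exI [of _ "\<lambda>n. c (- n)"] conjI ballI)
    show "(\<lambda>n. norm (c (- n))) summable_on UNIV"
      using summable_on_reindex_bij_betw [OF bij, of "\<lambda>n. norm (c n)"] c(1) by simp
  next
    fix z :: complex assume "z \<in> sphere 0 1"
    then have "((\<lambda>n. c n * inverse z powi n) has_sum f (inverse z)) UNIV"
      by (intro c(2)) (simp add: norm_inverse)
    then show "((\<lambda>n. c (- n) * z powi n) has_sum f (inverse z)) UNIV"
      using has_sum_reindex_bij_betw [OF bij, of "\<lambda>n. c n * inverse z powi n"]
      by (simp add: power_int_minus power_int_inverse)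
  qed
qed

section \<open>The factors as loops\<close>

lemma mem_loop_domain_iff: "z \<in> loop_domain \<longleftrightarrow> z \<in> \<real> \<and> z \<noteq> 0 \<or> norm z = 1"
  by (auto simp: loop_domain_def Reals_def)

lemma loop_domain_inverse: "z \<in> loop_domain \<Longrightarrow> inverse z \<in> loop_domain"
  by (auto simp: mem_loop_domain_iff norm_inverse)

lemma loop_domain_nonzero: "z \<in> loop_domain \<Longrightarrow> z \<noteq> 0"
  by (auto simp: mem_loop_domain_iff)

lemma one_in_loop_domain: "1 \<in> loop_domain"
  by (simp add: mem_loop_domain_iff)

section \<open>Where the normalising factor is holomorphic\<close>

definition radicand :: "complex \<Rightarrow> complex \<Rightarrow> complex" where
  "radicand a z = 1 + of_real ((cmod a)\<^sup>2) * z\<^sup>2"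

text \<open>On this set \<open>csqrt\<close> of the radicand is holomorphic, commutes with
  conjugation and does not vanish, since the removed slit contains 0.\<close>

definition slit_preimage :: "complex \<Rightarrow> complex set" where
  "slit_preimage a = {z. radicand a z \<notin> \<real>\<^sub>\<le>\<^sub>0}"

lemma e_plus_eq_mat2:
  "e_plus \<theta> a z =
     mat2 (cis \<theta> / csqrt (radicand a z)) (a * z / csqrt (radicand a z))
       (- cnj a * z / csqrt (radicand a z)) (cis (- \<theta>) / csqrt (radicand a z))"
  by (simp add: e_plus_def radicand_def map_matrix_mat2)

text \<open>The identity includes \<open>z = 0\<close>, because there \<open>inverse z\<close> and
  \<open>z powi (-2)\<close> both take the default value 0.\<close>

lemma e_minus_eq_e_plus_inverse: "e_minus \<kappa> b = (\<lambda>z. e_plus \<kappa> b (inverse z))"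
  by (rule ext) (simp add: e_minus_def e_plus_def power_int_minus power_inverse)

lemma radicand_nonzero: "z \<in> slit_preimage a \<Longrightarrow> radicand a z \<noteq> 0"
  by (auto simp: slit_preimage_def)

lemma open_slit_preimage: "open (slit_preimage a)"
proof -
  have "open (radicand a -` (- \<real>\<^sub>\<le>\<^sub>0))"
    unfolding radicand_def
    by (intro open_vimage continuous_intros open_Compl closed_nonpos_Reals_complex)
  then show ?thesis
    by (simp add: slit_preimage_def vimage_def)
qed

text \<open>Here \<open>|a z| < 1\<close>, so the radicand lies within distance less than 1 of 1 and
  has positive real part.\<close>

lemma ball_subset_slit_preimage:
  assumes "cmod a * R \<le> 1"
  shows "ball 0 R \<subseteq> slit_preimage a"
proof
  fix z :: complex assume z: "z \<in> ball 0 R"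
  have "cmod a * cmod z < 1"
  \<comment> \<open>Multiplying \<open>cmod z < R\<close> by \<open>cmod a\<close> keeps the
    inequality strict only for nonzero \<open>a\<close>.\<close>
  proof (cases "a = 0")
    case False
    then have "cmod a * cmod z < cmod a * R"
      using z by simp
    with assms show ?thesis by simp
  qed simp
  then have "cmod (of_real ((cmod a)\<^sup>2) * z\<^sup>2) < 1"
    using power_less_one_iff [of "cmod a * cmod z" 2]
    by (simp add: norm_mult norm_power power_mult_distrib power_less_one_iff)
  then have "Re (radicand a z) > 0"
    using abs_Re_le_cmod [of "of_real ((cmod a)\<^sup>2) * z\<^sup>2"] unfolding radicand_def by simp
  then show "z \<in> slit_preimage a"
    by (auto simp: slit_preimage_def complex_nonpos_Reals_iff)
qed

lemma slit_preimage_disk: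
  assumes "cmod a < 1"
  obtains R where "1 < R" "ball 0 R \<subseteq> slit_preimage a"
proof
  show "1 < 2 / (1 + cmod a)"
    using assms by (simp add: field_simps add_pos_nonneg)
  show "ball 0 (2 / (1 + cmod a)) \<subseteq> slit_preimage a"
    by (rule ball_subset_slit_preimage) (use assms in \<open>simp add: field_simps add_pos_nonneg\<close>)
qed

lemma cball_subset_slit_preimage:
  assumes "cmod a < 1"
  shows "cball 0 1 \<subseteq> slit_preimage a"
proof -
  obtain R where "1 < R" "ball 0 R \<subseteq> slit_preimage a"
    using slit_preimage_disk [OF assms] .
  then show ?thesis by (force simp: subset_iff)
qed

lemma loop_domain_subset_slit_preimage:
  assumes "cmod a < 1"
  shows "loop_domain \<subseteq> slit_preimage a"
proof
  fix z assume "z \<in> loop_domain"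
  then consider t :: real where "z = of_real t" | "z \<in> sphere 0 1"
    by (auto simp: loop_domain_def)
  then show "z \<in> slit_preimage a"
  proof cases
    case 1
    then have "radicand a z = of_real (1 + (cmod a)\<^sup>2 * t\<^sup>2)"
      by (simp add: radicand_def)
    moreover have "0 < 1 + (cmod a)\<^sup>2 * t\<^sup>2"
      by (simp add: add_pos_nonneg)
    ultimately have "0 < Re (radicand a z)"
      by simp
    then show ?thesis
      by (auto simp: slit_preimage_def complex_nonpos_Reals_iff)
  next
    case 2
    then show ?thesis
      using cball_subset_slit_preimage [OF assms] by auto
  qed
qed

section \<open>Verification of the loop group conditions\<close>

lemma holomorphic_e_plus: "(\<lambda>z. e_plus \<theta> a z $ i $ j) holomorphic_on slit_preimage a"
proof -
  have "(\<lambda>z. csqrt (radicand a z)) holomorphic_on slit_preimage a"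
    unfolding radicand_def
    by (intro holomorphic_intros) (auto simp: slit_preimage_def radicand_def)
  then have "(\<lambda>z. e_plus \<theta> a z $ i $ j) holomorphic_on slit_preimage a"
    if "i \<in> {1, 2}" "j \<in> {1, 2}" for i j :: 2
    using that unfolding e_plus_eq_mat2
    by (auto intro!: holomorphic_intros simp: radicand_nonzero)
  then show ?thesis
    using exhaust_2 by blast
qed

lemma det_e_plus:
  assumes "z \<in> slit_preimage a"
  shows "det (e_plus \<theta> a z) = 1"
proof -
  have "det (e_plus \<theta> a z) = (1 + a * cnj a * z\<^sup>2) / (csqrt (radicand a z))\<^sup>2"
    by (simp add: e_plus_eq_mat2 det_mat2 cis_mult power2_eq_square add_divide_distrib algebra_simps)
  also have "\<dots> = 1"
    using radicand_nonzero [OF assms] by (simp add: radicand_def complex_norm_square del: of_real_power)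
  finally show ?thesis .
qed

text \<open>Off the slit \<open>csqrt\<close> commutes with conjugation, so conjugating the value at
  \<open>cnj z\<close> conjugates only the parameters. Since the determinant is 1, the inverse is
  the adjugate, and transposing it restores the original matrix.\<close>

lemma e_plus_reality:
  assumes "z \<in> slit_preimage a"
  shows "e_plus \<theta> a z = transpose (matrix_inv (map_matrix cnj (e_plus \<theta> a (cnj z))))"
proof -
  define c where "c = csqrt (radicand a z)"
  have e: "e_plus \<theta> a z = mat2 (cis \<theta> / c) (a * z / c) (- cnj a * z / c) (cis (- \<theta>) / c)"
    by (simp add: e_plus_eq_mat2 c_def)
  have "radicand a (cnj z) = cnj (radicand a z)"
    by (simp add: radicand_def)
  then have "csqrt (radicand a (cnj z)) = cnj c"
    using assms by (simp add: c_def cnj_csqrt slit_preimage_def)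
  then have conj: "map_matrix cnj (e_plus \<theta> a (cnj z)) =
      mat2 (cis (- \<theta>) / c) (cnj a * z / c) (- a * z / c) (cis \<theta> / c)"
    by (simp add: e_plus_eq_mat2 map_matrix_mat2 cis_cnj)
  have "cis \<theta> / c * (cis (- \<theta>) / c) - a * z / c * (- cnj a * z / c) = 1"
    using det_e_plus [OF assms, of \<theta>] unfolding e det_mat2 .
  then have "cis (- \<theta>) / c * (cis \<theta> / c) - cnj a * z / c * (- a * z / c) = 1"
    by (simp add: mult_ac)
  from matrix_inv_mat2 [OF this] show ?thesis
    unfolding conj by (simp add: e transpose_mat2)
qed

text \<open>Conjugation by \<open>sigma3\<close> negates the off-diagonal entries, which are odd in
  \<open>z\<close>, while the radicand is even.\<close>

lemma e_plus_twisted: "sigma3 ** e_plus \<theta> a z ** matrix_inv sigma3 = e_plus \<theta> a (- z)"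
  unfolding matrix_inv_sigma3
  by (simp add: sigma3_def e_plus_eq_mat2 mat2_mult mat2_eq_iff radicand_def)

lemma wiener_e_plus:
  assumes "cmod a < 1"
  shows "wiener (\<lambda>z. e_plus \<theta> a z $ i $ j)"
proof -
  obtain R where "1 < R" "ball 0 R \<subseteq> slit_preimage a"
    using slit_preimage_disk [OF assms] .
  then show ?thesis
    using wiener_holomorphic holomorphic_on_subset [OF holomorphic_e_plus] by blast
qed

lemma extends_to_disk_e_plus:
  assumes "cmod a < 1"
  shows "extends_to_disk (e_plus \<theta> a)"
  unfolding extends_to_disk_def
proof (intro exI conjI allI ballI)
  have cont: "continuous_on (cball 0 1) (\<lambda>z. \<chi> i j. e_plus \<theta> a z $ i $ j)"
    by (intro continuous_on_vec_lambda holomorphic_on_imp_continuous_on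
        holomorphic_on_subset [OF holomorphic_e_plus] cball_subset_slit_preimage assms)
  then show "continuous_on (cball 0 1) (e_plus \<theta> a)"
    by simp
  show "(\<lambda>z. e_plus \<theta> a z $ i $ j) holomorphic_on ball 0 1" for i j
    by (rule holomorphic_on_subset [OF holomorphic_e_plus])
      (use cball_subset_slit_preimage [OF assms] ball_subset_cball in blast)
qed (use det_e_plus cball_subset_slit_preimage [OF assms] in auto)

lemma e_plus_in_LambdaSU2_plus:
  assumes "cmod a < 1"
  shows "e_plus \<theta> a \<in> LambdaSU2_plus"
proof -
  have dom: "z \<in> slit_preimage a" if "z \<in> loop_domain" for z
    using loop_domain_subset_slit_preimage [OF assms] that by blast
  have "smooth_on loop_domain (e_plus \<theta> a)"
    by (rule smooth_on_holomorphic_entries [OF open_slit_preimage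
          loop_domain_subset_slit_preimage [OF assms] holomorphic_e_plus])
  then show ?thesis
    unfolding LambdaSU2_plus_def LambdaSU2_def
    using assms by (auto simp: dom det_e_plus e_plus_twisted wiener_e_plus
        extends_to_disk_e_plus simp flip: e_plus_reality)
qed

lemma e_minus_in_LambdaSU2_minus:
  assumes "cmod b < 1"
  shows "e_minus \<kappa> b \<in> LambdaSU2_minus"
proof -
  have dom: "inverse z \<in> slit_preimage b" if "z \<in> loop_domain" for z
    using loop_domain_subset_slit_preimage [OF assms] loop_domain_inverse [OF that] by blast
  \<comment> \<open>The point 0 must be removed explicitly: \<open>inverse 0 = 0\<close> lies in
    \<open>slit_preimage b\<close>, yet inversion is not holomorphic there.\<close>
  define U where "U = inverse -` slit_preimage b \<inter> (- {0 :: complex})"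
  have "open U"
    unfolding U_def
    by (rule continuous_on_open_vimage [THEN iffD1, rule_format])
       (auto intro!: continuous_intros open_slit_preimage)
  moreover have "loop_domain \<subseteq> U"
    using dom loop_domain_nonzero by (auto simp: U_def)
  moreover have "(\<lambda>z. e_minus \<kappa> b z $ i $ j) holomorphic_on U" for i j
  proof -
    have "((\<lambda>z. e_plus \<kappa> b z $ i $ j) \<circ> inverse) holomorphic_on U"
      by (rule holomorphic_on_compose_gen [OF _ holomorphic_e_plus])
        (auto simp: U_def intro!: holomorphic_intros)
    then show ?thesis
      by (simp add: e_minus_eq_e_plus_inverse o_def)
  qed
  ultimately have "smooth_on loop_domain (e_minus \<kappa> b)"
    by (rule smooth_on_holomorphic_entries)
  moreover have "e_minus \<kappa> b z = transpose (matrix_inv (map_matrix cnj (e_minus \<kappa> b (cnj z))))"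
    if "z \<in> loop_domain" for z
    using e_plus_reality [OF dom [OF that]] by (simp add: e_minus_eq_e_plus_inverse)
  moreover have "wiener (\<lambda>z. e_minus \<kappa> b z $ i $ j)" for i j
    unfolding e_minus_eq_e_plus_inverse by (intro wiener_inverse wiener_e_plus assms)
  moreover have "sigma3 ** e_minus \<kappa> b z ** matrix_inv sigma3 = e_minus \<kappa> b (- z)" for z
    by (simp add: e_minus_eq_e_plus_inverse e_plus_twisted)
  \<comment> \<open>In the chart at infinity the two inversions cancel and \<open>e_minus\<close>
    becomes \<open>e_plus\<close>, including at \<open>w = 0\<close>.\<close>
  moreover have "extends_to_disk (\<lambda>w. e_minus \<kappa> b (inverse w))"
    using extends_to_disk_e_plus [OF assms] by (simp add: e_minus_eq_e_plus_inverse)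
  moreover have "det (e_minus \<kappa> b z) = 1" if "z \<in> loop_domain" for z
    using det_e_plus [OF dom [OF that]] by (simp add: e_minus_eq_e_plus_inverse)
  ultimately show ?thesis
    unfolding LambdaSU2_minus_def LambdaSU2_def by blast
qed

section \<open>The exchange relation\<close>

text \<open>Since \<open>cis (Arg w) = w / |w|\<close>, the left side is
  \<open>w * w * cnj w / |w|^2\<close>. This solves the diagonal equation of the exchange relation
  for the sum of the new angles.\<close>

lemma cis_double_Arg:
  assumes "w \<noteq> 0"
  shows "cis (2 * Arg w) * cnj w = w"
proof -
  have "cis (2 * Arg w) = sgn w * sgn w"
    using cis_mult [of "Arg w" "Arg w"] cis_Arg [OF assms] by simp
  also have "\<dots> * cnj w = w"
    using assms complex_norm_square [of w]
    by (simp add: sgn_eq field_simps power2_eq_square)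
  finally show ?thesis .
qed

lemma mat2_exchange:
  assumes "cmod (a * b) < 1" "refactor_params \<theta> \<kappa> a b \<theta>' \<kappa>' a' b'" "z \<noteq> 0"
  shows "mat2 (cis \<theta>) (a * z) (- cnj a * z) (cis (- \<theta>)) **
         mat2 (cis \<kappa>) (b * inverse z) (- cnj b * inverse z) (cis (- \<kappa>)) =
         mat2 (cis \<kappa>') (b' * inverse z) (- cnj b' * inverse z) (cis (- \<kappa>')) **
         mat2 (cis \<theta>') (a' * z) (- cnj a' * z) (cis (- \<theta>'))"
proof -
  define w where "w = 1 - a * cnj b * cis (- (\<theta> + \<kappa>))"
  have a': "a' = a * cis (- (\<kappa> + \<kappa>'))" and b': "b' = b * cis (\<theta> + \<theta>')"
    and S: "\<theta>' + \<kappa>' = \<theta> + \<kappa> + 2 * Arg w"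
    using assms(2) by (simp_all add: refactor_params_def w_def)
  have "cmod (a * cnj b * cis (- (\<theta> + \<kappa>))) < 1"
    using assms(1) by (simp add: norm_mult)
  then have "w \<noteq> 0"
    unfolding w_def by (metis eq_iff_diff_eq_0 less_irrefl norm_one)
  \<comment> \<open>The two sides are the (1,1) entries of the new and the old product. In
    \<open>b' * cnj a'\<close> the phases combine to
    \<open>cis (\<theta> + \<kappa>) * cis (\<theta>' + \<kappa>')\<close>, which is why only the
    sum of the new angles is constrained.\<close>
  have "cis (\<theta>' + \<kappa>') * cnj w = cis (\<theta> + \<kappa>) * w"
    using cis_double_Arg [OF \<open>w \<noteq> 0\<close>] by (simp add: S flip: cis_mult)
  then have diag: "cis \<theta> * cis \<kappa> - a * cnj b = cis \<theta>' * cis \<kappa>' - b' * cnj a'"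
    by (simp add: w_def a' b' cis_cnj algebra_simps cis_mult)
  have diag': "cis (- \<theta>) * cis (- \<kappa>) - cnj a * b = cis (- \<theta>') * cis (- \<kappa>') - cnj b' * a'"
    using arg_cong [OF diag, of cnj] by (simp add: cis_cnj)
  \<comment> \<open>These compare the coefficients of \<open>z\<close> and \<open>inverse z\<close>
    in the (1,2) entry; their conjugates \<open>off'\<close> treat the (2,1) entry.\<close>
  have off: "cis \<kappa>' * a' = cis (- \<kappa>) * a" "cis (- \<theta>') * b' = cis \<theta> * b"
    by (simp_all add: a' b' cis_mult)
  have off': "cis (- \<kappa>') * cnj a' = cis \<kappa> * cnj a" "cis \<theta>' * cnj b' = cis (- \<theta>) * cnj b"
    using off [THEN arg_cong, of cnj] by (simp_all add: cis_cnj)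
  show ?thesis
    unfolding mat2_mult mat2_eq_iff
  proof (intro conjI)
    show "cis \<theta> * cis \<kappa> + a * z * (- cnj b * inverse z) =
          cis \<kappa>' * cis \<theta>' + b' * inverse z * (- cnj a' * z)"
      using diag \<open>z \<noteq> 0\<close> by (simp add: mult_ac)
    show "cis \<theta> * (b * inverse z) + a * z * cis (- \<kappa>) =
          cis \<kappa>' * (a' * z) + b' * inverse z * cis (- \<theta>')"
    proof -
      have "cis \<theta> * (b * inverse z) + a * z * cis (- \<kappa>) =
            cis \<theta> * b * inverse z + cis (- \<kappa>) * a * z"
        by (simp add: mult_ac)
      also have "\<dots> = cis \<kappa>' * (a' * z) + b' * inverse z * cis (- \<theta>')"
        unfolding off [symmetric] by (simp add: mult_ac)
      finally show ?thesis .
    qed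
    show "- cnj a * z * cis \<kappa> + cis (- \<theta>) * (- cnj b * inverse z) =
          - cnj b' * inverse z * cis \<theta>' + cis (- \<kappa>') * (- cnj a' * z)"
    proof -
      have "- cnj a * z * cis \<kappa> + cis (- \<theta>) * (- cnj b * inverse z) =
            - (cis (- \<theta>) * cnj b) * inverse z - cis \<kappa> * cnj a * z"
        by (simp add: mult_ac)
      also have "\<dots> = - cnj b' * inverse z * cis \<theta>' + cis (- \<kappa>') * (- cnj a' * z)"
        unfolding off' [symmetric] by (simp add: mult_ac)
      finally show ?thesis .
    qed
    show "- cnj a * z * (b * inverse z) + cis (- \<theta>) * cis (- \<kappa>) =
          - cnj b' * inverse z * (a' * z) + cis (- \<kappa>') * cis (- \<theta>')"
      using diag' \<open>z \<noteq> 0\<close> by (simp add: field_simps)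
  qed
qed

lemma map_matrix_scale_mult:
  fixes A B :: "complex^2^2"
  shows "map_matrix ((*) r) A ** map_matrix ((*) s) B = map_matrix ((*) (r * s)) (A ** B)"
  by (simp add: vec_eq_iff forall_2 map_matrix_def matrix_matrix_mult_def sum_2 algebra_simps)

lemma e_plus_e_minus_exchange:
  assumes "cmod (a * b) < 1" "refactor_params \<theta> \<kappa> a b \<theta>' \<kappa>' a' b'" "z \<noteq> 0"
  shows "e_plus \<theta> a z ** e_minus \<kappa> b z = e_minus \<kappa>' b' z ** e_plus \<theta>' a' z"
proof -
  \<comment> \<open>Only phases change, so both products carry the same two scalar factors in
    opposite order, and the unnormalised identity suffices.\<close>
  have "cmod a' = cmod a" "cmod b' = cmod b"
    using assms(2) by (simp_all add: refactor_params_def norm_mult)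
  then show ?thesis
    using mat2_exchange [OF assms]
    by (simp add: e_plus_def e_minus_def map_matrix_scale_mult mult.commute)
qed

text \<open>Equal moduli give equal normalising factors, so the (1,1) entry determines the phase.
  This separates different choices of factors; it also applies to \<open>e_minus\<close>, as 1 is
  fixed by inversion.\<close>

lemma e_plus_at_1_eqD:
  assumes "e_plus \<theta> a 1 = e_plus \<theta>' a' 1" "cmod a' = cmod a" "cmod a < 1"
  shows "cis \<theta> = cis \<theta>'"
proof -
  have "1 \<in> slit_preimage a"
    using loop_domain_subset_slit_preimage [OF assms(3)] one_in_loop_domain by blast
  moreover have "radicand a' 1 = radicand a 1"
    using assms(2) by (simp add: radicand_def)
  ultimately show ?thesis
    using assms(1) by (auto simp: e_plus_eq_mat2 mat2_eq_iff dest: radicand_nonzero)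
qed

theorem lemma3p1:
  fixes \<theta> \<kappa> :: real and a b :: complex
  assumes "cmod a < 1" and "cmod b < 1"
  shows "(\<exists>ep\<in>LambdaSU2_plus. \<exists>em\<in>LambdaSU2_minus. \<forall>z\<in>loop_domain.
            e_plus \<theta> a z ** e_minus \<kappa> b z = em z ** ep z) \<and>
         (\<forall>\<theta>' \<kappa>' a' b'. refactor_params \<theta> \<kappa> a b \<theta>' \<kappa>' a' b' \<longrightarrow>
            e_plus \<theta>' a' \<in> LambdaSU2_plus \<and> e_minus \<kappa>' b' \<in> LambdaSU2_minus \<and>
            (\<forall>z\<in>loop_domain.
               e_plus \<theta> a z ** e_minus \<kappa> b z = e_minus \<kappa>' b' z ** e_plus \<theta>' a' z)) \<and>
         (\<exists>\<theta>1 \<kappa>1 a1 b1 \<theta>2 \<kappa>2 a2 b2.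
            refactor_params \<theta> \<kappa> a b \<theta>1 \<kappa>1 a1 b1 \<and> refactor_params \<theta> \<kappa> a b \<theta>2 \<kappa>2 a2 b2 \<and>
            (\<exists>z\<in>loop_domain. e_plus \<theta>1 a1 z \<noteq> e_plus \<theta>2 a2 z) \<and>
            (\<exists>z\<in>loop_domain. e_minus \<kappa>1 b1 z \<noteq> e_minus \<kappa>2 b2 z)) \<and>
         (\<exists>\<kappa>' a' b'. refactor_params \<theta> \<kappa> a b 0 \<kappa>' a' b') \<and>
         (\<exists>\<theta>' a' b'. refactor_params \<theta> \<kappa> a b \<theta>' 0 a' b')"
proof (intro conjI)
  have ab: "cmod (a * b) < 1"
    using assms mult_strict_mono' [of "cmod a" 1 "cmod b" 1] by (simp add: norm_mult)
  define p where "p = Arg (1 - a * cnj b * cis (- (\<theta> + \<kappa>)))"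
  \<comment> \<open>The angle \<open>\<theta>'\<close> is free: the prescribed sum then determines
    \<open>\<kappa>'\<close>, and the remaining relations define \<open>a'\<close> and
    \<open>b'\<close>.\<close>
  have params: "\<exists>a' b'. refactor_params \<theta> \<kappa> a b \<theta>' (\<theta> + \<kappa> + 2 * p - \<theta>') a' b'" for \<theta>'
    by (simp add: refactor_params_def p_def)
  have main: "e_plus \<theta>' a' \<in> LambdaSU2_plus \<and> e_minus \<kappa>' b' \<in> LambdaSU2_minus \<and>
      (\<forall>z\<in>loop_domain. e_plus \<theta> a z ** e_minus \<kappa> b z = e_minus \<kappa>' b' z ** e_plus \<theta>' a' z)"
    if "refactor_params \<theta> \<kappa> a b \<theta>' \<kappa>' a' b'" for \<theta>' \<kappa>' a' b'
  proof -
    have "cmod a' = cmod a" "cmod b' = cmod b"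
      using that by (simp_all add: refactor_params_def norm_mult)
    then show ?thesis
      using assms e_plus_e_minus_exchange [OF ab that]
      by (auto intro!: e_plus_in_LambdaSU2_plus e_minus_in_LambdaSU2_minus dest: loop_domain_nonzero)
  qed
  then show "\<forall>\<theta>' \<kappa>' a' b'. refactor_params \<theta> \<kappa> a b \<theta>' \<kappa>' a' b' \<longrightarrow>
      e_plus \<theta>' a' \<in> LambdaSU2_plus \<and> e_minus \<kappa>' b' \<in> LambdaSU2_minus \<and>
      (\<forall>z\<in>loop_domain. e_plus \<theta> a z ** e_minus \<kappa> b z = e_minus \<kappa>' b' z ** e_plus \<theta>' a' z)"
    by blast
  show "\<exists>ep\<in>LambdaSU2_plus. \<exists>em\<in>LambdaSU2_minus. \<forall>z\<in>loop_domain.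
      e_plus \<theta> a z ** e_minus \<kappa> b z = em z ** ep z"
    using params main by blast
  show "\<exists>\<kappa>' a' b'. refactor_params \<theta> \<kappa> a b 0 \<kappa>' a' b'"
    using params by blast
  \<comment> \<open>Giving \<open>\<theta>'\<close> the whole prescribed sum leaves 0 for
    \<open>\<kappa>'\<close>.\<close>
  show "\<exists>\<theta>' a' b'. refactor_params \<theta> \<kappa> a b \<theta>' 0 a' b'"
    using params [of "\<theta> + \<kappa> + 2 * p"] by auto
  obtain a1 b1 where 1: "refactor_params \<theta> \<kappa> a b 0 (\<theta> + \<kappa> + 2 * p) a1 b1"
    using params [of 0] by auto
  \<comment> \<open>Moving \<open>pi\<close> from one angle to the other keeps the sum and negates
    both phases, so both factors differ from those of the choice
    \<open>\<theta>' = 0\<close>.\<close>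
  obtain a2 b2 where 2: "refactor_params \<theta> \<kappa> a b pi (\<theta> + \<kappa> + 2 * p - pi) a2 b2"
    using params by blast
  have norms: "cmod a1 = cmod a" "cmod a2 = cmod a" "cmod b1 = cmod b" "cmod b2 = cmod b"
    using 1 2 by (simp_all add: refactor_params_def norm_mult)
  have "e_plus 0 a1 1 \<noteq> e_plus pi a2 1"
    using e_plus_at_1_eqD [of 0 a1 pi a2] norms assms by auto
  moreover have "e_minus (\<theta> + \<kappa> + 2 * p) b1 1 \<noteq> e_minus (\<theta> + \<kappa> + 2 * p - pi) b2 1"
    using e_plus_at_1_eqD [of "\<theta> + \<kappa> + 2 * p" b1 "\<theta> + \<kappa> + 2 * p - pi" b2] norms assms
    by (auto simp: e_minus_eq_e_plus_inverse simp flip: cis_divide)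
  ultimately show "\<exists>\<theta>1 \<kappa>1 a1 b1 \<theta>2 \<kappa>2 a2 b2.
      refactor_params \<theta> \<kappa> a b \<theta>1 \<kappa>1 a1 b1 \<and> refactor_params \<theta> \<kappa> a b \<theta>2 \<kappa>2 a2 b2 \<and>
      (\<exists>z\<in>loop_domain. e_plus \<theta>1 a1 z \<noteq> e_plus \<theta>2 a2 z) \<and>
      (\<exists>z\<in>loop_domain. e_minus \<kappa>1 b1 z \<noteq> e_minus \<kappa>2 b2 z)"
    using 1 2 one_in_loop_domain by blast
qed

end
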